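(* Let $(\mathfrak g,[\cdot,\cdot,\cdot]_{\mathfrak g})$ be a $3$-Lie algebra, $V$ a vector space, and let $\rho:\wedge^2\mathfrak g\to\mathfrak{gl}(V)$, $\nu:\mathfrak g\to\mathrm{Hom}(\wedge^2V,V)$, $\omega:\wedge^3\mathfrak g\to V$ be linear maps. The following two statements are equivalent: (a) $(\mathfrak g\oplus V,[\cdot,\cdot,\cdot]_{(\rho,\nu,\omega)})$ is a $3$-Lie algebra, which is a non-split abelian extension of $\mathfrak g$ by $V$, where $$\begin{aligned}[x_1+v_1,x_2+v_2,x_3+v_3]_{(\rho,\nu,\omega)}=&[x_1,x_2,x_3]_{\mathfrak g}+\rho(x_1,x_2)(v_3)+\rho(x_3,x_1)(v_2)+\rho(x_2,x_3)(v_1)\\&+\nu(x_1)(v_2,v_3)+\nu(x_2)(v_3,v_1)+\nu(x_3)(v_1,v_2)+\omega(x_1,x_2,x_3);\end{aligned}$$ (b) $\bar\rho+\bar\nu+\omega$ is a Maurer-Cartan element of the differential graded Lie algebra $(C_>(\mathfrak g\oplus V,V),[\cdot,\cdot]^{\mathrm{3Lie}},\delta)$.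
   Context: All vector spaces are over an algebraically closed field $\mathbb K$ of characteristic $0$. A $3$-Lie algebra is a vector space $\mathfrak g$ with a skew-symmetric trilinear map $[\cdot,\cdot,\cdot]:\otimes^3\mathfrak g\to\mathfrak g$ satisfying the Fundamental Identity: $[x_1,x_2,[x_3,x_4,x_5]]=[[x_1,x_2,x_3],x_4,x_5]+[x_3,[x_1,x_2,x_4],x_5]+[x_3,x_4,[x_1,x_2,x_5]]$ for all $x_i\in\mathfrak g$. An abelian extension of $\mathfrak g$ by $V$ is an exact sequence of $3$-Lie algebras $0\to V\to\hat{\mathfrak g}\xrightarrow{p}\mathfrak g\to0$ in which $V$ is abelian (zero bracket). A splitting is a linear map $\sigma:\mathfrak g\to\hat{\mathfrak g}$ with $p\circ\sigma=\mathrm{id}_{\mathfrak g}$. The abelian extension is called split if there exists a splitting which is also a homomorphism of $3$-Lie algebras, and non-split otherwise. Graded Lie algebra of a vector space $W$. For $p\ge 0$ let $C^p(W,W)$ be the space of linear maps $\alpha:(\wedge^2W)^{\otimes p}\otimes W\to W$ which (for $p\ge1$) are skew-symmetric in the last three arguments, i.e. linear maps on $\wedge^2W\otimes\cdots\otimes\wedge^2W\wedge W$ ($p$ factors $\wedge^2W$). For $\alpha\in C^p(W,W)$, $\beta\in C^q(W,W)$ put $[\alpha,\beta]^{\mathrm{3Lie}}=(-1)^{pq}\alpha\circ\beta-\beta\circ\alpha\in C^{p+q}(W,W)$. Here, for $\mathfrak X_i=x_i\wedge y_i\in\wedge^2W$ ($1\le i\le p+q$) and $x\in W$, $$\begin{aligned}\alpha\circ\beta(\mathfrak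 X_1,\ldots,\mathfrak X_{p+q},x)=&\sum_{J,\,j_{q+1}<p+q+1}(-1)^{(J,I)}(-1)^k\Big(\alpha(\mathfrak X_{i_1},\ldots,\mathfrak X_{i_k},\beta(\mathfrak X_{j_1},\ldots,\mathfrak X_{j_q},x_{j_{q+1}})\wedge y_{j_{q+1}},\mathfrak X_{i_{k+1}},\ldots,\mathfrak X_{i_{p-1}},x)\\&\quad+\alpha(\mathfrak X_{i_1},\ldots,\mathfrak X_{i_k},x_{j_{q+1}}\wedge\beta(\mathfrak X_{j_1},\ldots,\mathfrak X_{j_q},y_{j_{q+1}}),\mathfrak X_{i_{k+1}},\ldots,\mathfrak X_{i_{p-1}},x)\Big)\\&+\sum_{J,\,j_{q+1}=p+q+1}(-1)^{(J,I)}(-1)^p\alpha(\mathfrak X_{i_1},\ldots,\mathfrak X_{i_p},\beta(\mathfrak X_{j_1},\ldots,\mathfrak X_{j_q},x)),\end{aligned}$$ where $J=\{j_1<\cdots<j_{q+1}\}$ runs over the $(q+1)$-element subsets of $N=\{1,\ldots,p+q+1\}$, $I=\{i_1<\cdots<i_p\}=N\setminus J$, $(-1)^{(J,I)}$ is the sign of the permutation $(j_1,\ldots,j_{q+1},i_1,\ldots,i_p)$, and $k$ is determined by $i_k<j_{q+1}<i_{k+1}$ ($k=0$ if $j_{q+1}<i_1$, $k=p-1$ if $j_{q+1}>i_{p-1}$). This makes $\oplus_pC^p(W,W)$ a graded Lie algebra (known fact). Take $W=\mathfrak g\oplus V$, regarded as the $3$-Lie algebra direct sum with bracket $\pi(x+u,y+v,z+w)=[x,y,z]_{\mathfrak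 g}$, and let $\delta$ be the coboundary operator of this $3$-Lie algebra with coefficients in its adjoint representation; it satisfies $\delta(\alpha)=[\pi,\alpha]^{\mathrm{3Lie}}$ for all $\alpha\in C^p(W,W)$ (known fact). $C^p(\mathfrak g\oplus V,V)\subset C^p(W,W)$ is the subspace of $V$-valued cochains, and $C^p_>(\mathfrak g\oplus V,V)$ is the subspace with $C^p(\mathfrak g\oplus V,V)=C^p_>(\mathfrak g\oplus V,V)\oplus C^p(V,V)$, i.e. the $V$-valued cochains vanishing whenever all arguments lie in $V$. $C_>(\mathfrak g\oplus V,V)=\oplus_{p\ge0}C^p_>(\mathfrak g\oplus V,V)$ is a sub-differential graded Lie algebra of $(\oplus_pC^p(W,W),[\cdot,\cdot]^{\mathrm{3Lie}},\delta)$. $\bar\rho(x+u,y+v,z+w)=\rho(x,y)(w)+\rho(y,z)(u)+\rho(z,x)(v)$, $\bar\nu(x+u,y+v,z+w)=\nu(x)(v\wedge w)+\nu(y)(w\wedge u)+\nu(z)(u\wedge v)$, and $\omega$ is extended to $\wedge^3(\mathfrak g\oplus V)$ by zero. A Maurer-Cartan element of a differential graded Lie algebra $(L,[\cdot,\cdot],\mathrm d)$ is $P\in L_1$ with $\mathrm dP+\frac12[P,P]=0$.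
   Formalization: As stated, (b) does not imply "non-split" (ρ=ν=ω=0 satisfies (b) but the extension is split); proved instead: (a) without "non-split" is equivalent to (b), and (a) with "non-split" is equivalent to (b) together with non-splitness. *)

theory Defs
  imports
    "HOL-Analysis.Product_Vector"
    "HOL-Library.Function_Algebras"
    "HOL-Combinatorics.Permutations"
    "HOL-Computational_Algebra.Polynomial"
begin

section \<open>3-Lie algebras and abelian extensions\<close>

definition trilinear ::
  "('k::field \<Rightarrow> 'a::ab_group_add \<Rightarrow> 'a) \<Rightarrow> ('k \<Rightarrow> 'b::ab_group_add \<Rightarrow> 'b) \<Rightarrow>
   ('k \<Rightarrow> 'c::ab_group_add \<Rightarrow> 'c) \<Rightarrow> ('k \<Rightarrow> 'd::ab_group_add \<Rightarrow> 'd) \<Rightarrow>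
   ('a \<Rightarrow> 'b \<Rightarrow> 'c \<Rightarrow> 'd) \<Rightarrow> bool" where
  "trilinear sa sb sc sd f \<longleftrightarrow>
     (\<forall>y z. Vector_Spaces.linear sa sd (\<lambda>x. f x y z)) \<and>
     (\<forall>x z. Vector_Spaces.linear sb sd (\<lambda>y. f x y z)) \<and>
     (\<forall>x y. Vector_Spaces.linear sc sd (\<lambda>z. f x y z))"

definition skew3 :: "('a \<Rightarrow> 'a \<Rightarrow> 'a \<Rightarrow> 'b::ab_group_add) \<Rightarrow> bool" where
  "skew3 f \<longleftrightarrow> (\<forall>x y z. f y x z = - f x y z \<and> f x z y = - f x y z)"

locale three_Lie_algebra = vector_space scale
  for scale :: "'k::field \<Rightarrow> 'a::ab_group_add \<Rightarrow> 'a" +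
  fixes br :: "'a \<Rightarrow> 'a \<Rightarrow> 'a \<Rightarrow> 'a"
  assumes br_trilinear: "trilinear scale scale scale scale br"
    and br_skew: "skew3 br"
    and fundamental_identity:
      "br x1 x2 (br x3 x4 x5) =
         br (br x1 x2 x3) x4 x5 + br x3 (br x1 x2 x4) x5 + br x3 x4 (br x1 x2 x5)"

definition three_Lie_hom ::
  "('k::field \<Rightarrow> 'a::ab_group_add \<Rightarrow> 'a) \<Rightarrow> ('a \<Rightarrow> 'a \<Rightarrow> 'a \<Rightarrow> 'a) \<Rightarrow>
   ('k \<Rightarrow> 'b::ab_group_add \<Rightarrow> 'b) \<Rightarrow> ('b \<Rightarrow> 'b \<Rightarrow> 'b \<Rightarrow> 'b) \<Rightarrow> ('a \<Rightarrow> 'b) \<Rightarrow> bool" where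
  "three_Lie_hom sa bra sb brb f \<longleftrightarrow>
     Vector_Spaces.linear sa sb f \<and> (\<forall>x y z. f (bra x y z) = brb (f x) (f y) (f z))"

definition abelian_extension ::
  "('k::field \<Rightarrow> 'v::ab_group_add \<Rightarrow> 'v) \<Rightarrow>
   ('k \<Rightarrow> 'h::ab_group_add \<Rightarrow> 'h) \<Rightarrow> ('h \<Rightarrow> 'h \<Rightarrow> 'h \<Rightarrow> 'h) \<Rightarrow>
   ('k \<Rightarrow> 'g::ab_group_add \<Rightarrow> 'g) \<Rightarrow> ('g \<Rightarrow> 'g \<Rightarrow> 'g \<Rightarrow> 'g) \<Rightarrow>
   ('v \<Rightarrow> 'h) \<Rightarrow> ('h \<Rightarrow> 'g) \<Rightarrow> bool" where
  "abelian_extension sv sh bh sg bg i p \<longleftrightarrow>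
     three_Lie_algebra sv (\<lambda>_ _ _. 0) \<and> three_Lie_algebra sh bh \<and> three_Lie_algebra sg bg \<and>
     three_Lie_hom sv (\<lambda>_ _ _. 0) sh bh i \<and> three_Lie_hom sh bh sg bg p \<and>
     inj i \<and> range i = {h. p h = 0} \<and> surj p"

definition splitting ::
  "('k::field \<Rightarrow> 'h::ab_group_add \<Rightarrow> 'h) \<Rightarrow> ('k \<Rightarrow> 'g::ab_group_add \<Rightarrow> 'g) \<Rightarrow>
   ('h \<Rightarrow> 'g) \<Rightarrow> ('g \<Rightarrow> 'h) \<Rightarrow> bool" where
  "splitting sh sg p \<sigma> \<longleftrightarrow> Vector_Spaces.linear sg sh \<sigma> \<and> p \<circ> \<sigma> = id"

definition split_extension ::
  "('k::field \<Rightarrow> 'h::ab_group_add \<Rightarrow> 'h) \<Rightarrow> ('h \<Rightarrow> 'h \<Rightarrow> 'h \<Rightarrow> 'h) \<Rightarrow>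
   ('k \<Rightarrow> 'g::ab_group_add \<Rightarrow> 'g) \<Rightarrow> ('g \<Rightarrow> 'g \<Rightarrow> 'g \<Rightarrow> 'g) \<Rightarrow> ('h \<Rightarrow> 'g) \<Rightarrow> bool" where
  "split_extension sh bh sg bg p \<longleftrightarrow>
     (\<exists>\<sigma>. splitting sh sg p \<sigma> \<and> three_Lie_hom sg bg sh bh \<sigma>)"

section \<open>Cochains\<close>

text \<open>
  A linear map on \<open>(\<And>\<^sup>2 W)\<^sup>\<otimes>\<^sup>p \<otimes> W\<close> is given by its values on decomposable elements,
  that is, by a function of a list of \<open>p\<close> pairs \<open>x \<and> y\<close> and one further vector
  which is multilinear and skew-symmetric in each pair. Linearity in the second entry of a pair
  follows from skew-symmetry. On lists of the wrong length a cochain is \<open>0\<close>, so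
  that equality of functions is equality of cochains.
\<close>

type_synonym ('w, 'm) cochain = "('w \<times> 'w) list \<Rightarrow> 'w \<Rightarrow> 'm"

definition cochains ::
  "('k::field \<Rightarrow> 'w::ab_group_add \<Rightarrow> 'w) \<Rightarrow> ('k \<Rightarrow> 'm::ab_group_add \<Rightarrow> 'm) \<Rightarrow> nat \<Rightarrow>
   ('w, 'm) cochain set" where
  "cochains sw sm p = {\<alpha>.
     (\<forall>Xs x. length Xs \<noteq> p \<longrightarrow> \<alpha> Xs x = 0) \<and>
     (\<forall>Xs. length Xs = p \<longrightarrow> Vector_Spaces.linear sw sm (\<alpha> Xs)) \<and>
     (\<forall>Xs x i. length Xs = p \<and> i < p \<longrightarrow>
        (\<forall>v. Vector_Spaces.linear sw sm (\<lambda>u. \<alpha> (Xs[i := (u, v)]) x)) \<and>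
        (\<forall>u v. \<alpha> (Xs[i := (v, u)]) x = - \<alpha> (Xs[i := (u, v)]) x)) \<and>
     (\<forall>Xs x y z. Suc (length Xs) = p \<longrightarrow> \<alpha> (Xs @ [(x, z)]) y = - \<alpha> (Xs @ [(x, y)]) z)}"

definition cochain1 :: "('w \<Rightarrow> 'w \<Rightarrow> 'w \<Rightarrow> 'm::zero) \<Rightarrow> ('w, 'm) cochain" where
  "cochain1 f Xs z = (case Xs of [(x, y)] \<Rightarrow> f x y z | _ \<Rightarrow> 0)"

text \<open>
  The positions of the arguments are numbered from \<open>0\<close>, so that
  \<open>{..p + q}\<close> is the index set \<open>N\<close> and \<open>p + q\<close> is the position of the last vector \<open>x\<close>;
  \<open>js\<close> and \<open>is\<close> list \<open>J\<close> and \<open>N - J\<close> in increasing order. If \<open>last js < p + q\<close>,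
  then \<open>last is = p + q\<close>, and \<open>k\<close> is the number of elements of \<open>is\<close> below \<open>last js\<close>.
\<close>

definition shuffle_sign :: "nat list \<Rightarrow> nat list \<Rightarrow> int" where
  "shuffle_sign js is =
     sign (permutation_of_list (zip [0..<length js + length is] (js @ is)))"

definition circ_term ::
  "('k::field \<Rightarrow> 'w::ab_group_add \<Rightarrow> 'w) \<Rightarrow> nat \<Rightarrow> nat \<Rightarrow> ('w, 'w) cochain \<Rightarrow> ('w, 'w) cochain \<Rightarrow>
   nat list \<Rightarrow> nat list \<Rightarrow> ('w, 'w) cochain" where
  "circ_term sw p q \<alpha> \<beta> js is Xs x =
     (let j = last js; Ys = map ((!) Xs) (butlast js) in
      if j = p + q then sw ((-1) ^ p) (\<alpha> (map ((!) Xs) is) (\<beta> Ys x))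
      else
        let k = length (filter (\<lambda>i. i < j) is);
            Ls = map ((!) Xs) (take k is);
            Rs = map ((!) Xs) (drop k (butlast is));
            xj = fst (Xs ! j); yj = snd (Xs ! j)
        in sw ((-1) ^ k)
             (\<alpha> (Ls @ [(\<beta> Ys xj, yj)] @ Rs) x + \<alpha> (Ls @ [(xj, \<beta> Ys yj)] @ Rs) x))"

definition circ ::
  "('k::field \<Rightarrow> 'w::ab_group_add \<Rightarrow> 'w) \<Rightarrow> nat \<Rightarrow> nat \<Rightarrow> ('w, 'w) cochain \<Rightarrow> ('w, 'w) cochain \<Rightarrow>
   ('w, 'w) cochain" where
  "circ sw p q \<alpha> \<beta> Xs x =
     (if length Xs = p + q then
        \<Sum>J | J \<subseteq> {..p + q} \<and> card J = q + 1.
          let js = sorted_list_of_set J; is = sorted_list_of_set ({..p + q} - J)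
          in sw (of_int (shuffle_sign js is)) (circ_term sw p q \<alpha> \<beta> js is Xs x)
      else 0)"

definition bracket_3Lie ::
  "('k::field \<Rightarrow> 'w::ab_group_add \<Rightarrow> 'w) \<Rightarrow> nat \<Rightarrow> nat \<Rightarrow> ('w, 'w) cochain \<Rightarrow> ('w, 'w) cochain \<Rightarrow>
   ('w, 'w) cochain" where
  "bracket_3Lie sw p q \<alpha> \<beta> Xs x =
     sw ((-1) ^ (p * q)) (circ sw p q \<alpha> \<beta> Xs x) - circ sw q p \<beta> \<alpha> Xs x"

text \<open>
  The coboundary operator \<open>\<delta> : C\<^sup>p(W, M) \<rightarrow> C\<^sup>p\<^sup>+\<^sup>1(W, M)\<close> of a 3-Lie algebra \<open>(W, br)\<close> with
  coefficients in a representation \<open>\<rho> : \<And>\<^sup>2 W \<rightarrow> gl(M)\<close>. For arguments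
  \<open>X\<^sub>1 = x\<^sub>1 \<and> y\<^sub>1, \<dots>, X\<^sub>p\<^sub>+\<^sub>1 = x\<^sub>p\<^sub>+\<^sub>1 \<and> y\<^sub>p\<^sub>+\<^sub>1\<close> and \<open>z\<close> it is the sum of

  \<^item> \<open>(-1)\<^sup>j \<alpha>(\<dots>, omit X\<^sub>j, \<dots>, [x\<^sub>j, y\<^sub>j, x\<^sub>k] \<and> y\<^sub>k + x\<^sub>k \<and> [x\<^sub>j, y\<^sub>j, y\<^sub>k], \<dots>, z)\<close> over \<open>j < k\<close>,
  \<^item> \<open>(-1)\<^sup>j \<alpha>(\<dots>, omit X\<^sub>j, \<dots>, [x\<^sub>j, y\<^sub>j, z])\<close> over \<open>j\<close>,
  \<^item> \<open>(-1)\<^sup>j\<^sup>+\<^sup>1 \<rho>(x\<^sub>j, y\<^sub>j) \<alpha>(\<dots>, omit X\<^sub>j, \<dots>, z)\<close> over \<open>j\<close>,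
  \<^item> \<open>(-1)\<^sup>p (\<rho>(y\<^sub>p\<^sub>+\<^sub>1, z) \<alpha>(X\<^sub>1, \<dots>, X\<^sub>p, x\<^sub>p\<^sub>+\<^sub>1) + \<rho>(z, x\<^sub>p\<^sub>+\<^sub>1) \<alpha>(X\<^sub>1, \<dots>, X\<^sub>p, y\<^sub>p\<^sub>+\<^sub>1))\<close>.

  The definition numbers the arguments from \<open>0\<close>, which shifts the exponents in the
  first three sums.
\<close>

definition omit_nth :: "nat \<Rightarrow> 'a list \<Rightarrow> 'a list" where
  "omit_nth j xs = take j xs @ drop (Suc j) xs"

definition coboundary ::
  "('k::field \<Rightarrow> 'm::ab_group_add \<Rightarrow> 'm) \<Rightarrow> ('w \<Rightarrow> 'w \<Rightarrow> 'w \<Rightarrow> 'w) \<Rightarrow> ('w \<Rightarrow> 'w \<Rightarrow> 'm \<Rightarrow> 'm) \<Rightarrow>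
   nat \<Rightarrow> ('w, 'm) cochain \<Rightarrow> ('w, 'm) cochain" where
  "coboundary sm br \<rho> p \<alpha> Xs z =
     (if length Xs = p + 1 then
        let x = (\<lambda>j. fst (Xs ! j)); y = (\<lambda>j. snd (Xs ! j)) in
        (\<Sum>k\<le>p. \<Sum>j<k. sm ((-1) ^ (j + 1))
           (\<alpha> (omit_nth j (Xs[k := (br (x j) (y j) (x k), y k)])) z +
            \<alpha> (omit_nth j (Xs[k := (x k, br (x j) (y j) (y k))])) z)) +
        (\<Sum>j\<le>p. sm ((-1) ^ (j + 1)) (\<alpha> (omit_nth j Xs) (br (x j) (y j) z))) +
        (\<Sum>j\<le>p. sm ((-1) ^ j) (\<rho> (x j) (y j) (\<alpha> (omit_nth j Xs) z))) +
        sm ((-1) ^ p) (\<rho> (y p) z (\<alpha> (butlast Xs) (x p)) + \<rho> z (x p) (\<alpha> (butlast Xs) (y p)))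
      else 0)"

section \<open>Maurer-Cartan elements\<close>

text \<open>
  The operations of a differential graded Lie algebra on homogeneous elements; bracket and
  differential take the degrees of their arguments as parameters.
\<close>

record ('k, 'a) dgla =
  component :: "nat \<Rightarrow> 'a set"
  smult :: "'k \<Rightarrow> 'a \<Rightarrow> 'a"
  lie :: "nat \<Rightarrow> nat \<Rightarrow> 'a \<Rightarrow> 'a \<Rightarrow> 'a"
  differential :: "nat \<Rightarrow> 'a \<Rightarrow> 'a"

definition maurer_cartan :: "('k::field, 'a::ab_group_add, 'more) dgla_scheme \<Rightarrow> 'a \<Rightarrow> bool" where
  "maurer_cartan L P \<longleftrightarrow>
     P \<in> component L 1 \<and> differential L 1 P + smult L (1/2) (lie L 1 1 P P) = 0"

section \<open>The differential graded Lie algebra of an extension problem\<close>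

abbreviation prod_scale ::
  "('k::field \<Rightarrow> 'g::ab_group_add \<Rightarrow> 'g) \<Rightarrow> ('k \<Rightarrow> 'v::ab_group_add \<Rightarrow> 'v) \<Rightarrow>
   'k \<Rightarrow> 'g \<times> 'v \<Rightarrow> 'g \<times> 'v" where
  "prod_scale \<equiv> module_prod.scale"

definition direct_sum_bracket ::
  "('g \<Rightarrow> 'g \<Rightarrow> 'g \<Rightarrow> 'g) \<Rightarrow> 'g \<times> 'v::zero \<Rightarrow> 'g \<times> 'v \<Rightarrow> 'g \<times> 'v \<Rightarrow> 'g \<times> 'v" where
  "direct_sum_bracket bg a b c = (bg (fst a) (fst b) (fst c), 0)"

definition cochains_V ::
  "('k::field \<Rightarrow> 'g::ab_group_add \<Rightarrow> 'g) \<Rightarrow> ('k \<Rightarrow> 'v::ab_group_add \<Rightarrow> 'v) \<Rightarrow> nat \<Rightarrow>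
   ('g \<times> 'v, 'g \<times> 'v) cochain set" where
  "cochains_V sg sv p =
     {\<alpha> \<in> cochains (prod_scale sg sv) (prod_scale sg sv) p. \<forall>Xs x. fst (\<alpha> Xs x) = 0}"

definition cochains_gt ::
  "('k::field \<Rightarrow> 'g::ab_group_add \<Rightarrow> 'g) \<Rightarrow> ('k \<Rightarrow> 'v::ab_group_add \<Rightarrow> 'v) \<Rightarrow> nat \<Rightarrow>
   ('g \<times> 'v, 'g \<times> 'v) cochain set" where
  "cochains_gt sg sv p =
     {\<alpha> \<in> cochains_V sg sv p. \<forall>Xs x.
        (\<forall>X\<in>set Xs. fst (fst X) = 0 \<and> fst (snd X) = 0) \<and> fst x = 0 \<longrightarrow> \<alpha> Xs x = 0}"

definition dgla_gt ::
  "('k::field \<Rightarrow> 'g::ab_group_add \<Rightarrow> 'g) \<Rightarrow> ('g \<Rightarrow> 'g \<Rightarrow> 'g \<Rightarrow> 'g) \<Rightarrow>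
   ('k \<Rightarrow> 'v::ab_group_add \<Rightarrow> 'v) \<Rightarrow> ('k, ('g \<times> 'v, 'g \<times> 'v) cochain) dgla" where
  "dgla_gt sg bg sv =
     \<lparr>component = cochains_gt sg sv,
      smult = (\<lambda>c \<alpha> Xs x. prod_scale sg sv c (\<alpha> Xs x)),
      lie = bracket_3Lie (prod_scale sg sv),
      differential =
        coboundary (prod_scale sg sv) (direct_sum_bracket bg) (direct_sum_bracket bg)\<rparr>"

definition rho_bar ::
  "('g \<Rightarrow> 'g \<Rightarrow> 'v \<Rightarrow> 'v::ab_group_add) \<Rightarrow>
   'g::zero \<times> 'v \<Rightarrow> 'g \<times> 'v \<Rightarrow> 'g \<times> 'v \<Rightarrow> 'g \<times> 'v" where
  "rho_bar \<rho> = (\<lambda>(x, u) (y, v) (z, w). (0, \<rho> x y w + \<rho> y z u + \<rho> z x v))"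

definition nu_bar ::
  "('g \<Rightarrow> 'v \<Rightarrow> 'v \<Rightarrow> 'v::ab_group_add) \<Rightarrow>
   'g::zero \<times> 'v \<Rightarrow> 'g \<times> 'v \<Rightarrow> 'g \<times> 'v \<Rightarrow> 'g \<times> 'v" where
  "nu_bar \<nu> = (\<lambda>(x, u) (y, v) (z, w). (0, \<nu> x v w + \<nu> y w u + \<nu> z u v))"

definition omega_ext ::
  "('g \<Rightarrow> 'g \<Rightarrow> 'g \<Rightarrow> 'v) \<Rightarrow> 'g::zero \<times> 'v \<Rightarrow> 'g \<times> 'v \<Rightarrow> 'g \<times> 'v \<Rightarrow> 'g \<times> 'v" where
  "omega_ext \<omega> = (\<lambda>(x, u) (y, v) (z, w). (0, \<omega> x y z))"

definition extension_bracket ::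
  "('g \<Rightarrow> 'g \<Rightarrow> 'g \<Rightarrow> 'g) \<Rightarrow> ('g \<Rightarrow> 'g \<Rightarrow> 'v \<Rightarrow> 'v::ab_group_add) \<Rightarrow>
   ('g \<Rightarrow> 'v \<Rightarrow> 'v \<Rightarrow> 'v) \<Rightarrow> ('g \<Rightarrow> 'g \<Rightarrow> 'g \<Rightarrow> 'v) \<Rightarrow>
   'g \<times> 'v \<Rightarrow> 'g \<times> 'v \<Rightarrow> 'g \<times> 'v \<Rightarrow> 'g \<times> 'v" where
  "extension_bracket bg \<rho> \<nu> \<omega> = (\<lambda>(x1, v1) (x2, v2) (x3, v3).
     (bg x1 x2 x3,
      \<rho> x1 x2 v3 + \<rho> x3 x1 v2 + \<rho> x2 x3 v1 +
      \<nu> x1 v2 v3 + \<nu> x2 v3 v1 + \<nu> x3 v1 v2 + \<omega> x1 x2 x3))"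

text \<open>
  For \<open>\<rho> = 0\<close>, \<open>\<nu> = 0\<close>, \<open>\<omega> = 0\<close> the Maurer-Cartan equation holds and the extension is the
  direct sum, which is split. So Maurer-Cartan elements describe abelian extensions which
  are not necessarily split, and non-splitness is a separate condition.
\<close>

lemma zero_maurer_cartan_and_split:
  fixes sg :: "'k::field \<Rightarrow> 'g::ab_group_add \<Rightarrow> 'g"
    and sv :: "'k \<Rightarrow> 'v::ab_group_add \<Rightarrow> 'v"
  assumes "three_Lie_algebra sg bg" and "vector_space sv"
  shows "maurer_cartan (dgla_gt sg bg sv)
           (cochain1 (rho_bar (\<lambda>_ _ _. 0) + nu_bar (\<lambda>_ _ _. 0) + omega_ext (\<lambda>_ _ _. 0)))"
    and "split_extension (prod_scale sg sv)
           (extension_bracket bg (\<lambda>_ _ _. 0) (\<lambda>_ _ _. 0) (\<lambda>_ _ _. 0)) sg bg fst"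
proof -
  interpret g: vector_space sg
    using assms(1) by (simp add: three_Lie_algebra_def)
  interpret v: vector_space sv by fact
  interpret gv: vector_space_prod sg sv ..
  have zero: "cochain1 (rho_bar (\<lambda>_ _ _. 0) + nu_bar (\<lambda>_ _ _. 0) + omega_ext (\<lambda>_ _ _. 0))
      = (0 :: ('g \<times> 'v, 'g \<times> 'v) cochain)"
    by (intro ext)
      (auto simp: cochain1_def rho_bar_def nu_bar_def omega_ext_def zero_prod_def
         split: list.splits prod.splits)
  have lin0: "Vector_Spaces.linear gv.scale gv.scale (\<lambda>_. 0)"
    by unfold_locales (auto simp: gv.scale_def zero_prod_def)
  have bg: "trilinear sg sg sg sg bg"
    using assms(1) by (rule three_Lie_algebra.br_trilinear)
  have bg0: "bg 0 y z = 0" "bg x 0 z = 0" "bg x y 0 = 0" for x y z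
  proof -
    have "Vector_Spaces.linear sg sg (\<lambda>x. bg x y z)" "Vector_Spaces.linear sg sg (\<lambda>y. bg x y z)"
      "Vector_Spaces.linear sg sg (\<lambda>z. bg x y z)"
      using bg unfolding trilinear_def by blast+
    then show "bg 0 y z = 0" "bg x 0 z = 0" "bg x y 0 = 0"
      unfolding linear_iff_module_hom by (auto dest: module_hom.zero)
  qed
  have "coboundary gv.scale (direct_sum_bracket bg) (direct_sum_bracket bg) 1 0
      = (0 :: ('g \<times> 'v, 'g \<times> 'v) cochain)"
    by (intro ext) (simp add: coboundary_def direct_sum_bracket_def bg0 zero_fun_def flip: zero_prod_def)
  moreover have "circ_term gv.scale 1 1 0 0 js ks Xs x = 0" for js ks Xs x
    by (simp add: circ_term_def Let_def zero_fun_def)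
  then have "bracket_3Lie gv.scale 1 1 0 0 = (0 :: ('g \<times> 'v, 'g \<times> 'v) cochain)"
    by (intro ext) (simp add: bracket_3Lie_def circ_def zero_fun_def)
  ultimately show "maurer_cartan (dgla_gt sg bg sv)
      (cochain1 (rho_bar (\<lambda>_ _ _. 0) + nu_bar (\<lambda>_ _ _. 0) + omega_ext (\<lambda>_ _ _. 0)))"
    unfolding zero
    by (auto simp: maurer_cartan_def dgla_gt_def cochains_gt_def cochains_V_def cochains_def
        lin0 zero_fun_def)
  have "Vector_Spaces.linear sg gv.scale (\<lambda>x. (x, 0))"
    by unfold_locales (auto simp: gv.scale_def)
  then show "split_extension gv.scale
      (extension_bracket bg (\<lambda>_ _ _. 0) (\<lambda>_ _ _. 0) (\<lambda>_ _ _. 0)) sg bg fst"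
    unfolding split_extension_def splitting_def three_Lie_hom_def
    by (intro exI[of _ "\<lambda>x. (x, 0)"]) (auto simp: extension_bracket_def)
qed

end

theory Submission
  imports Defs
begin

text \<open>
  Write \<open>\<pi>\<close> for the direct sum bracket on \<open>\<gg> \<oplus> V\<close> and \<open>N\<close> for the sum of \<open>rho_bar \<rho>\<close>, \<open>nu_bar \<nu>\<close>
  and the extension of \<open>\<omega>\<close> by zero, so that the bracket of the
  extension is \<open>\<pi> + N\<close>. For a ternary operation \<open>f\<close> let \<open>F(f)\<close> be the difference of the two sides
  of the Fundamental Identity. The sum over shuffles that defines \<open>f \<circ> f\<close> for a cochain of
  degree 1 has three index sets, and its four terms add up to \<open>-F(f)\<close>
  (\<open>circ_cochain1\<close>); since the degrees are odd, \<open>\<onehalf>[f, f] = -f \<circ> f = F(f)\<close>.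

  The expression \<open>F(f)\<close> is quadratic in \<open>f\<close>. Hence \<open>F(\<pi> + N) = F(\<pi>) + M + F(N)\<close>, where the mixed part
  \<open>M\<close> is what the coboundary operator of \<open>\<pi>\<close> makes of \<open>N\<close> (\<open>coboundary_cochain1\<close>), and
  \<open>F(\<pi>) = 0\<close> because \<open>\<gg>\<close> is a 3-Lie algebra. So the left-hand side \<open>\<delta>N + \<onehalf>[N, N]\<close> of the
  Maurer-Cartan equation equals \<open>F(\<pi> + N)\<close>, and the equation says that \<open>\<pi> + N\<close> satisfies the
  Fundamental Identity (\<open>maurer_cartan_iff_fundamental_identity\<close>).

  The remaining conditions on both sides hold for all linear \<open>\<rho>, \<nu>, \<omega>\<close>
  with the assumed symmetries: the bracket \<open>\<pi> + N\<close> is trilinear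
  and skew-symmetric, \<open>N\<close> lies in \<open>C\<^sup>1\<^sub>>(\<gg> \<oplus> V, V)\<close>, and the bracket \<open>\<pi> + N\<close> vanishes on \<open>V\<close> and projects
  onto that of \<open>\<gg>\<close>, which makes the extension abelian as soon as it is a 3-Lie algebra.
  Non-splitness is the same condition on both sides.
\<close>

section \<open>Trilinear and skew-symmetric maps\<close>

lemma linear_iff_add_scale:
  assumes "vector_space s" "vector_space t"
  shows "Vector_Spaces.linear s t f \<longleftrightarrow>
    (\<forall>x y. f (x + y) = f x + f y) \<and> (\<forall>c x. f (s c x) = t c (f x))"
  using assms
  by (simp add: linear_iff_module_hom module_hom_def module_hom_axioms_def module_iff_vector_space)

lemma trilinear_iff:
  assumes "vector_space sa" "vector_space sb" "vector_space sc" "vector_space sd"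
  shows "trilinear sa sb sc sd f \<longleftrightarrow>
    (\<forall>x x' y z. f (x + x') y z = f x y z + f x' y z) \<and>
    (\<forall>x y y' z. f x (y + y') z = f x y z + f x y' z) \<and>
    (\<forall>x y z z'. f x y (z + z') = f x y z + f x y z') \<and>
    (\<forall>c x y z. f (sa c x) y z = sd c (f x y z)) \<and>
    (\<forall>c x y z. f x (sb c y) z = sd c (f x y z)) \<and>
    (\<forall>c x y z. f x y (sc c z) = sd c (f x y z))"
  using assms by (auto simp: trilinear_def linear_iff_add_scale)

lemma trilinear_zero:
  assumes "trilinear sa sb sc sd f"
  shows "f 0 y z = 0" "f x 0 z = 0" "f x y 0 = 0"
proof -
  have "Vector_Spaces.linear sa sd (\<lambda>x. f x y z)" "Vector_Spaces.linear sb sd (\<lambda>y. f x y z)"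
    "Vector_Spaces.linear sc sd (\<lambda>z. f x y z)"
    using assms unfolding trilinear_def by blast+
  then show "f 0 y z = 0" "f x 0 z = 0" "f x y 0 = 0"
    unfolding linear_iff_module_hom by (auto dest: module_hom.zero)
qed

lemma skew3D:
  assumes "skew3 f"
  shows "f y x z = - f x y z" "f x z y = - f x y z"
  using assms unfolding skew3_def by blast+

lemma skew3_cyclic: "skew3 f \<Longrightarrow> f y z x = f x y z"
  by (metis minus_minus skew3D)

lemma trilinear_add:
  assumes "vector_space s" "trilinear s s s s f" "trilinear s s s s g"
  shows "trilinear s s s s (f + g)"
proof -
  interpret vector_space s by fact
  show ?thesis
    using assms(2,3) unfolding trilinear_iff[OF assms(1,1,1,1)]
    by (simp add: scale_right_distrib)
qed

lemma skew3_add: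
  assumes "skew3 f" "skew3 g"
  shows "skew3 (f + g)"
  unfolding skew3_def
proof (intro allI)
  fix x y z
  show "(f + g) y x z = - (f + g) x y z \<and> (f + g) x z y = - (f + g) x y z"
    using skew3D[OF assms(1), of x y z] skew3D[OF assms(2), of x y z] by simp
qed

section \<open>The bracket and the coboundary of cochains of degree 1\<close>

text \<open>
  In degree \<open>(1, 1)\<close> the index sets \<open>J\<close> are the pairs of positions among \<open>0, 1, 2\<close>. The numerals are
  written with \<open>Suc\<close> because unfolding \<open>circ\<close> at \<open>p = q = 1\<close> produces them in this form.
\<close>

lemma subsets_of_card_two:
  "{J. J \<subseteq> {..Suc (Suc 0)} \<and> card J = Suc (Suc 0)} =
    {{0, Suc 0}, {0, Suc (Suc 0)}, {Suc 0, Suc (Suc 0)}}"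
proof -
  have "{J. J \<subseteq> {..Suc (Suc 0)} \<and> card J = Suc (Suc 0)} =
      {J \<in> Pow {0, Suc 0, Suc (Suc 0)}. card J = Suc (Suc 0)}"
    by (auto simp: atMost_Suc)
  also have "\<dots> = {{0, Suc 0}, {0, Suc (Suc 0)}, {Suc 0, Suc (Suc 0)}}"
    by (simp add: Pow_insert) auto
  finally show ?thesis .
qed

lemma shuffle_sign_1_2:
  "shuffle_sign [0, Suc 0] [Suc (Suc 0)] = 1"
  "shuffle_sign [0, Suc (Suc 0)] [Suc 0] = -1"
  "shuffle_sign [Suc 0, Suc (Suc 0)] [0] = 1"
proof -
  have "permutation_of_list [(0, 0), (Suc 0, Suc 0), (Suc (Suc 0), Suc (Suc 0))] = id"
    by (auto simp: fun_eq_iff permutation_of_list_def)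
  then show "shuffle_sign [0, Suc 0] [Suc (Suc 0)] = 1"
    by (simp add: shuffle_sign_def)
  have "permutation_of_list [(0, 0), (Suc 0, Suc (Suc 0)), (Suc (Suc 0), Suc 0)] =
      transpose (Suc 0) (Suc (Suc 0))"
    by (auto simp: fun_eq_iff permutation_of_list_def transpose_def)
  then show "shuffle_sign [0, Suc (Suc 0)] [Suc 0] = -1"
    by (simp add: shuffle_sign_def sign_swap_id)
  have "permutation_of_list [(0, Suc 0), (Suc 0, Suc (Suc 0)), (Suc (Suc 0), 0)] =
      transpose 0 (Suc 0) \<circ> transpose (Suc 0) (Suc (Suc 0))"
    by (auto simp: fun_eq_iff permutation_of_list_def transpose_def)
  then show "shuffle_sign [Suc 0, Suc (Suc 0)] [0] = 1"
    by (simp add: shuffle_sign_def sign_compose sign_swap_id permutation_swap_id)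
qed

text \<open>
  The first two terms come from \<open>J = {0, 1}\<close>, where \<open>g\<close> acts on the pair \<open>c \<and> d\<close>; the third from
  \<open>J = {0, 2}\<close>, where the odd shuffle cancels the sign \<open>(-1)\<^sup>p = -1\<close>; the last from \<open>J = {1, 2}\<close>,
  where the shuffle is even and that sign remains.
\<close>

lemma circ_cochain1:
  assumes "vector_space s"
  shows "circ s 1 1 (cochain1 f) (cochain1 g) [(a, b), (c, d)] e =
    f (g a b c) d e + f c (g a b d) e + f c d (g a b e) - f a b (g c d e)"
proof -
  interpret vector_space s by fact
  have complements: "{..Suc (Suc 0)} - {0, Suc 0} = {Suc (Suc 0)}"
    "{..Suc (Suc 0)} - {0, Suc (Suc 0)} = {Suc 0}"
    "{..Suc (Suc 0)} - {Suc 0, Suc (Suc 0)} = {0}"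
    by auto
  show ?thesis
    by (simp add: circ_def subsets_of_card_two complements Let_def shuffle_sign_1_2
        circ_term_def cochain1_def doubleton_eq_iff)
qed

definition fundamental_defect ::
  "('a \<Rightarrow> 'a \<Rightarrow> 'a \<Rightarrow> 'a) \<Rightarrow> 'a \<Rightarrow> 'a \<Rightarrow> 'a \<Rightarrow> 'a \<Rightarrow> 'a \<Rightarrow> 'a::ab_group_add" where
  "fundamental_defect f a b c d e =
     f a b (f c d e) - (f (f a b c) d e + f c (f a b d) e + f c d (f a b e))"

lemma bracket_3Lie_cochain1_self:
  assumes "vector_space s"
  shows "bracket_3Lie s 1 1 (cochain1 f) (cochain1 f) [(a, b), (c, d)] e =
    fundamental_defect f a b c d e + fundamental_defect f a b c d e"
proof -
  interpret vector_space s by fact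
  show ?thesis
    by (simp add: bracket_3Lie_def circ_cochain1[OF assms, simplified] fundamental_defect_def
        algebra_simps)
qed

text \<open>
  The result is \<open>[\<pi>, f]\<close> for the bracket \<open>\<pi>\<close>, that is, the part of the fundamental defect of \<open>\<pi> + f\<close>
  that is linear in each of \<open>\<pi>\<close> and \<open>f\<close>. The coboundary operator writes two of its
  terms with the cochain value in the last place of the bracket; cyclic invariance
  moves it to where the Fundamental Identity has it.
\<close>

lemma coboundary_cochain1:
  assumes "vector_space s" and "skew3 br"
  shows "coboundary s br br 1 (cochain1 f) [(a, b), (c, d)] e =
    br a b (f c d e) - (br (f a b c) d e + br c (f a b d) e + br c d (f a b e)) +
    (f a b (br c d e) - (f (br a b c) d e + f c (br a b d) e + f c d (br a b e)))"
proof -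
  interpret vector_space s by fact
  have "br d e (f a b c) = br (f a b c) d e" "br e c (f a b d) = br c (f a b d) e"
    using assms(2) by (metis skew3_cyclic)+
  then show ?thesis
    by (simp add: coboundary_def cochain1_def omit_nth_def Let_def algebra_simps)
qed

text \<open>
  Characteristic 0 enters through the factor \<open>1/2\<close>, which undoes the doubling in \<open>[f, f]\<close>.
\<close>

lemma maurer_cartan_iff_fundamental_identity:
  fixes s :: "'k::field_char_0 \<Rightarrow> 'w::ab_group_add \<Rightarrow> 'w"
  assumes s: "vector_space s"
    and tri_br: "trilinear s s s s br" and "skew3 br"
    and fund_br: "\<And>a b c d e. fundamental_defect br a b c d e = 0"
    and tri_f: "trilinear s s s s f"
  shows "coboundary s br br 1 (cochain1 f) +
      (\<lambda>Xs x. s (1/2) (bracket_3Lie s 1 1 (cochain1 f) (cochain1 f) Xs x)) = 0 \<longleftrightarrow>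
    (\<forall>a b c d e. fundamental_defect (br + f) a b c d e = 0)"
    (is "?mc = 0 \<longleftrightarrow> _")
proof -
  interpret vector_space s by fact
  have half: "s (1/2) (x + x) = x" for x
    using scale_left_distrib[of "1/2" "1/2" x] by (simp add: scale_right_distrib)
  have "s (1/2) (bracket_3Lie s 1 1 (cochain1 f) (cochain1 f) [(a, b), (c, d)] e)
      = fundamental_defect f a b c d e" for a b c d e
    unfolding bracket_3Lie_cochain1_self[OF s] by (rule half)
  then have "?mc [(a, b), (c, d)] e = fundamental_defect (br + f) a b c d e" for a b c d e
    using tri_br tri_f fund_br[of a b c d e]
    unfolding trilinear_iff[OF s s s s] plus_fun_apply coboundary_cochain1[OF s \<open>skew3 br\<close>]
    by (simp add: fundamental_defect_def algebra_simps)
  moreover have "?mc Xs x = 0" if "length Xs \<noteq> 2" for Xs x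
    using that by (simp add: coboundary_def bracket_3Lie_def circ_def)
  moreover have "\<exists>a b c d. Xs = [(a, b), (c, d)]" if "length Xs = 2" for Xs :: "('w \<times> 'w) list"
    using that by (auto simp: length_Suc_conv numeral_2_eq_2)
  ultimately show ?thesis
    unfolding fun_eq_iff zero_fun_def by metis
qed

lemma cochain1_in_cochains:
  fixes s :: "'k::field \<Rightarrow> 'w::ab_group_add \<Rightarrow> 'w"
  assumes "trilinear s s s s f" and "skew3 f"
  shows "cochain1 f \<in> cochains s s 1"
proof -
  have linear3: "Vector_Spaces.linear s s (cochain1 f [(x, y)])" for x y
    using assms(1) by (simp add: cochain1_def[abs_def] trilinear_def)
  have linear1: "Vector_Spaces.linear s s (\<lambda>u. cochain1 f [(u, y)] z)" for y z
    using assms(1) by (simp add: cochain1_def trilinear_def)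
  have skew: "cochain1 f [(y, x)] z = - cochain1 f [(x, y)] z"
    "cochain1 f [(x, z)] y = - cochain1 f [(x, y)] z" for x y z
    using skew3D[OF assms(2), of x y z] by (simp_all add: cochain1_def)
  have degree: "cochain1 f Xs z = 0" if "length Xs \<noteq> 1" for Xs z
    using that by (auto simp: cochain1_def split: list.splits)
  have singleton: "\<exists>x y. Xs = [(x, y)]" if "length Xs = 1" for Xs :: "('w \<times> 'w) list"
    using that by (auto simp: length_Suc_conv)
  show ?thesis
    unfolding cochains_def mem_Collect_eq
  proof (intro conjI allI impI)
    fix Xs :: "('w \<times> 'w) list" and x assume "length Xs \<noteq> 1"
    then show "cochain1 f Xs x = 0" by (rule degree)
  next
    fix Xs :: "('w \<times> 'w) list" assume "length Xs = 1"
    then show "Vector_Spaces.linear s s (cochain1 f Xs)"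
      using singleton linear3 by metis
  next
    fix Xs :: "('w \<times> 'w) list" and x v and i :: nat assume "length Xs = 1 \<and> i < 1"
    then show "Vector_Spaces.linear s s (\<lambda>u. cochain1 f (Xs[i := (u, v)]) x)"
      using singleton[of Xs] linear1[of v x] by auto
  next
    fix Xs :: "('w \<times> 'w) list" and x u v and i :: nat assume "length Xs = 1 \<and> i < 1"
    then show "cochain1 f (Xs[i := (v, u)]) x = - cochain1 f (Xs[i := (u, v)]) x"
      using singleton[of Xs] skew(1)[of v u x] by auto
  next
    fix Xs :: "('w \<times> 'w) list" and x y z assume "Suc (length Xs) = 1"
    then show "cochain1 f (Xs @ [(x, z)]) y = - cochain1 f (Xs @ [(x, y)]) z"
      using skew(2)[of x z y] by simp
  qed
qed

section \<open>The bracket of the extension\<close>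

lemma extension_bracket_eq:
  fixes bg :: "'g::ab_group_add \<Rightarrow> 'g \<Rightarrow> 'g \<Rightarrow> 'g"
    and \<rho> :: "'g \<Rightarrow> 'g \<Rightarrow> 'v \<Rightarrow> 'v::ab_group_add"
  shows "extension_bracket bg \<rho> \<nu> \<omega> =
    direct_sum_bracket bg + (rho_bar \<rho> + nu_bar \<nu> + omega_ext \<omega>)"
  by (auto simp: fun_eq_iff extension_bracket_def direct_sum_bracket_def rho_bar_def nu_bar_def
      omega_ext_def)

lemma three_Lie_algebra_iff:
  assumes "vector_space s" "trilinear s s s s f" "skew3 f"
  shows "three_Lie_algebra s f \<longleftrightarrow> (\<forall>a b c d e. fundamental_defect f a b c d e = 0)"
  using assms
  by (simp add: three_Lie_algebra_def three_Lie_algebra_axioms_def fundamental_defect_def)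

context
  fixes sg :: "'k::field \<Rightarrow> 'g::ab_group_add \<Rightarrow> 'g"
    and sv :: "'k \<Rightarrow> 'v::ab_group_add \<Rightarrow> 'v"
  assumes sg: "vector_space sg" and sv: "vector_space sv"
begin

interpretation g: vector_space sg by (rule sg)
interpretation v: vector_space sv by (rule sv)
interpretation gv: vector_space_prod sg sv ..

lemmas trilinear_prod_iff = trilinear_iff[OF gv.p.vector_space_axioms gv.p.vector_space_axioms
    gv.p.vector_space_axioms gv.p.vector_space_axioms]

lemma trilinear_direct_sum_bracket:
  assumes "trilinear sg sg sg sg bg"
  shows "trilinear gv.scale gv.scale gv.scale gv.scale (direct_sum_bracket bg)"
  using assms
  unfolding trilinear_iff[OF sg sg sg sg] trilinear_prod_iff
  by (simp add: direct_sum_bracket_def gv.scale_def)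

lemma trilinear_rho_bar:
  assumes "trilinear sg sg sv sv \<rho>"
  shows "trilinear gv.scale gv.scale gv.scale gv.scale (rho_bar \<rho>)"
  using assms
  unfolding trilinear_iff[OF sg sg sv sv] trilinear_prod_iff
  by (simp add: rho_bar_def gv.scale_def v.scale_right_distrib split_beta)

lemma trilinear_nu_bar:
  assumes "trilinear sg sv sv sv \<nu>"
  shows "trilinear gv.scale gv.scale gv.scale gv.scale (nu_bar \<nu>)"
  using assms
  unfolding trilinear_iff[OF sg sv sv sv] trilinear_prod_iff
  by (simp add: nu_bar_def gv.scale_def v.scale_right_distrib split_beta)

lemma trilinear_omega_ext:
  assumes "trilinear sg sg sg sv \<omega>"
  shows "trilinear gv.scale gv.scale gv.scale gv.scale (omega_ext \<omega>)"
  using assms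
  unfolding trilinear_iff[OF sg sg sg sv] trilinear_prod_iff
  by (simp add: omega_ext_def gv.scale_def split_beta)

end

lemma skew3_direct_sum_bracket:
  assumes "skew3 bg"
  shows "skew3 (direct_sum_bracket bg :: 'g::ab_group_add \<times> 'v::ab_group_add \<Rightarrow> _)"
  unfolding skew3_def
proof (intro allI)
  fix a b c :: "'g \<times> 'v"
  show "direct_sum_bracket bg b a c = - direct_sum_bracket bg a b c \<and>
      direct_sum_bracket bg a c b = - direct_sum_bracket bg a b c"
    using skew3D[OF assms, of "fst a" "fst b" "fst c"] by (simp add: direct_sum_bracket_def)
qed

lemma skew3_rho_bar:
  assumes "\<And>x y v. \<rho> y x v = - \<rho> x y v"
  shows "skew3 (rho_bar \<rho>)"
proof -
  have "rho_bar \<rho> (y, v) (x, u) (z, w) = - rho_bar \<rho> (x, u) (y, v) (z, w)"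
    "rho_bar \<rho> (x, u) (z, w) (y, v) = - rho_bar \<rho> (x, u) (y, v) (z, w)" for x y z u v w
    using assms[of x y] assms[of y z] assms[of x z] by (simp_all add: rho_bar_def)
  then show ?thesis
    unfolding skew3_def by (metis prod.collapse)
qed

lemma skew3_nu_bar:
  assumes "\<And>x u v. \<nu> x v u = - \<nu> x u v"
  shows "skew3 (nu_bar \<nu>)"
proof -
  have "nu_bar \<nu> (y, v) (x, u) (z, w) = - nu_bar \<nu> (x, u) (y, v) (z, w)"
    "nu_bar \<nu> (x, u) (z, w) (y, v) = - nu_bar \<nu> (x, u) (y, v) (z, w)" for x y z u v w
    using assms[of _ u v] assms[of _ v w] assms[of _ u w] by (simp_all add: nu_bar_def)
  then show ?thesis
    unfolding skew3_def by (metis prod.collapse)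
qed

lemma skew3_omega_ext:
  assumes "skew3 \<omega>"
  shows "skew3 (omega_ext \<omega>)"
proof -
  have "omega_ext \<omega> (y, v) (x, u) (z, w) = - omega_ext \<omega> (x, u) (y, v) (z, w)"
    "omega_ext \<omega> (x, u) (z, w) (y, v) = - omega_ext \<omega> (x, u) (y, v) (z, w)" for x y z u v w
    using skew3D[OF assms, of x y z] by (simp_all add: omega_ext_def)
  then show ?thesis
    unfolding skew3_def by (metis prod.collapse)
qed

section \<open>Abelian extensions and Maurer-Cartan elements\<close>

text \<open>
  Every term of the extension bracket has an argument in \<open>\<gg>\<close>, so three elements of \<open>V\<close> have bracket \<open>0\<close>.
\<close>

lemma abelian_extension_of_three_Lie_algebra:
  fixes sg :: "'k::field \<Rightarrow> 'g::ab_group_add \<Rightarrow> 'g"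
    and sv :: "'k \<Rightarrow> 'v::ab_group_add \<Rightarrow> 'v"
  assumes g: "three_Lie_algebra sg bg" and V: "vector_space sv"
    and rho: "trilinear sg sg sv sv \<rho>"
    and nu: "trilinear sg sv sv sv \<nu>"
    and omega: "trilinear sg sg sg sv \<omega>"
    and E: "three_Lie_algebra (prod_scale sg sv) (extension_bracket bg \<rho> \<nu> \<omega>)"
  shows "abelian_extension sv (prod_scale sg sv) (extension_bracket bg \<rho> \<nu> \<omega>) sg bg
      (\<lambda>v. (0, v)) fst"
proof -
  interpret g: three_Lie_algebra sg bg by fact
  interpret v: vector_space sv by fact
  interpret gv: vector_space_prod sg sv ..
  have "three_Lie_algebra sv (\<lambda>_ _ _. 0)"
    by (auto simp: three_Lie_algebra_def three_Lie_algebra_axioms_def V skew3_def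
        trilinear_iff[OF V V V V])
  moreover have "three_Lie_hom sv (\<lambda>_ _ _. 0) gv.scale (extension_bracket bg \<rho> \<nu> \<omega>) (\<lambda>v. (0, v))"
    by (simp add: three_Lie_hom_def linear_iff_add_scale[OF V gv.p.vector_space_axioms] gv.scale_def
        extension_bracket_def trilinear_zero[OF g.br_trilinear] trilinear_zero[OF rho]
        trilinear_zero[OF nu] trilinear_zero[OF omega] flip: zero_prod_def)
  moreover have "three_Lie_hom gv.scale (extension_bracket bg \<rho> \<nu> \<omega>) sg bg fst"
    by (simp add: three_Lie_hom_def gv.scale_def extension_bracket_def split_beta
        linear_iff_add_scale[OF gv.p.vector_space_axioms g.vector_space_axioms])
  moreover have "range (\<lambda>v. (0, v)) = {h :: 'g \<times> 'v. fst h = 0}"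
    by (auto simp: image_iff)
  ultimately show ?thesis
    using g E by (auto simp: abelian_extension_def inj_on_def)
qed

lemma cochain1_in_cochains_gt:
  fixes sg :: "'k::field \<Rightarrow> 'g::ab_group_add \<Rightarrow> 'g"
    and sv :: "'k \<Rightarrow> 'v::ab_group_add \<Rightarrow> 'v"
  assumes g: "vector_space sg" and V: "vector_space sv"
    and rho: "trilinear sg sg sv sv \<rho>" "\<And>x y v. \<rho> y x v = - \<rho> x y v"
    and nu: "trilinear sg sv sv sv \<nu>" "\<And>x u v. \<nu> x v u = - \<nu> x u v"
    and omega: "trilinear sg sg sg sv \<omega>" "skew3 \<omega>"
  shows "cochain1 (rho_bar \<rho> + nu_bar \<nu> + omega_ext \<omega>) \<in> cochains_gt sg sv 1"
proof -
  interpret g: vector_space sg by fact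
  interpret v: vector_space sv by fact
  interpret gv: vector_space_prod sg sv ..
  show ?thesis
    unfolding cochains_gt_def cochains_V_def mem_Collect_eq
  proof (intro conjI allI impI)
    show "cochain1 (rho_bar \<rho> + nu_bar \<nu> + omega_ext \<omega>) \<in> cochains gv.scale gv.scale 1"
      by (intro cochain1_in_cochains trilinear_add skew3_add gv.p.vector_space_axioms
          trilinear_rho_bar trilinear_nu_bar trilinear_omega_ext
          skew3_rho_bar skew3_nu_bar skew3_omega_ext assms)
    fix Xs :: "(('g \<times> 'v) \<times> ('g \<times> 'v)) list" and x :: "'g \<times> 'v"
    show "fst (cochain1 (rho_bar \<rho> + nu_bar \<nu> + omega_ext \<omega>) Xs x) = 0"
      by (auto simp: cochain1_def rho_bar_def nu_bar_def omega_ext_def split_beta split: list.split)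
    assume "(\<forall>X\<in>set Xs. fst (fst X) = 0 \<and> fst (snd X) = 0) \<and> fst x = 0"
    then show "cochain1 (rho_bar \<rho> + nu_bar \<nu> + omega_ext \<omega>) Xs x = 0"
      by (auto simp: cochain1_def rho_bar_def nu_bar_def omega_ext_def
          trilinear_zero[OF rho(1)] trilinear_zero[OF nu(1)] trilinear_zero[OF omega(1)]
          zero_prod_def split_beta split: list.split)
  qed
qed

theorem proposition5p5:
  fixes sg :: "'k::{alg_closed_field, field_char_0} \<Rightarrow> 'g::ab_group_add \<Rightarrow> 'g"
    and bg :: "'g \<Rightarrow> 'g \<Rightarrow> 'g \<Rightarrow> 'g"
    and sv :: "'k \<Rightarrow> 'v::ab_group_add \<Rightarrow> 'v"
    and \<rho> :: "'g \<Rightarrow> 'g \<Rightarrow> 'v \<Rightarrow> 'v"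
    and \<nu> :: "'g \<Rightarrow> 'v \<Rightarrow> 'v \<Rightarrow> 'v"
    and \<omega> :: "'g \<Rightarrow> 'g \<Rightarrow> 'g \<Rightarrow> 'v"
  assumes g: "three_Lie_algebra sg bg"
    and V: "vector_space sv"
    and rho: "trilinear sg sg sv sv \<rho>" "\<And>x y v. \<rho> y x v = - \<rho> x y v"
    and nu: "trilinear sg sv sv sv \<nu>" "\<And>x u v. \<nu> x v u = - \<nu> x u v"
    and omega: "trilinear sg sg sg sv \<omega>" "skew3 \<omega>"
  shows "((three_Lie_algebra (prod_scale sg sv) (extension_bracket bg \<rho> \<nu> \<omega>) \<and>
           abelian_extension sv (prod_scale sg sv) (extension_bracket bg \<rho> \<nu> \<omega>) sg bg
             (\<lambda>v. (0, v)) fst)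
          \<longleftrightarrow>
          maurer_cartan (dgla_gt sg bg sv)
            (cochain1 (rho_bar \<rho> + nu_bar \<nu> + omega_ext \<omega>)))
         \<and>
         ((three_Lie_algebra (prod_scale sg sv) (extension_bracket bg \<rho> \<nu> \<omega>) \<and>
           abelian_extension sv (prod_scale sg sv) (extension_bracket bg \<rho> \<nu> \<omega>) sg bg
             (\<lambda>v. (0, v)) fst \<and>
           \<not> split_extension (prod_scale sg sv) (extension_bracket bg \<rho> \<nu> \<omega>) sg bg fst)
          \<longleftrightarrow>
          (maurer_cartan (dgla_gt sg bg sv)
             (cochain1 (rho_bar \<rho> + nu_bar \<nu> + omega_ext \<omega>)) \<and>
           \<not> split_extension (prod_scale sg sv) (extension_bracket bg \<rho> \<nu> \<omega>) sg bg fst))"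
proof -
  interpret g: three_Lie_algebra sg bg by fact
  interpret v: vector_space sv by fact
  interpret gv: vector_space_prod sg sv ..
  note vs = gv.p.vector_space_axioms
  let ?\<pi> = "direct_sum_bracket bg :: 'g \<times> 'v \<Rightarrow> _"
  let ?N = "rho_bar \<rho> + nu_bar \<nu> + omega_ext \<omega>"
  have \<pi>: "trilinear gv.scale gv.scale gv.scale gv.scale ?\<pi>" "skew3 ?\<pi>"
    by (intro trilinear_direct_sum_bracket skew3_direct_sum_bracket g.br_trilinear g.br_skew
        g.vector_space_axioms V)+
  have N: "trilinear gv.scale gv.scale gv.scale gv.scale ?N" "skew3 ?N"
    by (intro trilinear_add skew3_add vs trilinear_rho_bar trilinear_nu_bar trilinear_omega_ext
        skew3_rho_bar skew3_nu_bar skew3_omega_ext assms g.vector_space_axioms)+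
  have \<pi>_fundamental: "fundamental_defect ?\<pi> a b c d e = 0" for a b c d e
    using g.fundamental_identity[of "fst a" "fst b" "fst c" "fst d" "fst e"]
    by (simp add: fundamental_defect_def direct_sum_bracket_def flip: zero_prod_def)
  have "three_Lie_algebra gv.scale (extension_bracket bg \<rho> \<nu> \<omega>) \<longleftrightarrow>
      (\<forall>a b c d e. fundamental_defect (?\<pi> + ?N) a b c d e = 0)"
    unfolding extension_bracket_eq
    by (intro three_Lie_algebra_iff vs trilinear_add skew3_add \<pi> N)
  also have "\<dots> \<longleftrightarrow> maurer_cartan (dgla_gt sg bg sv) (cochain1 ?N)"
    using maurer_cartan_iff_fundamental_identity[OF vs \<pi> \<pi>_fundamental N(1)]
      cochain1_in_cochains_gt[OF g.vector_space_axioms V rho nu omega]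
    by (simp add: maurer_cartan_def dgla_gt_def)
  finally show ?thesis
    using abelian_extension_of_three_Lie_algebra[OF g V rho(1) nu(1) omega(1)] by blast
qed

end
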